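(* An extended system is complete if and only if it contains $\mathbf{Mp}$.
   Context: Formulas are built from literals (propositional variables $P$ and their complements $\bar P$) using $\wedge$ and $\vee$. Negation satisfies $\neg P=\bar P$ and is extended by De Morgan's laws. A sequent is a nonempty finite multiset of formulas. A comma denotes multiset union, and $\Gamma,\Delta,\Sigma$ denote possibly empty multisets. A formula is valid if it evaluates to $1$ under every $0/1$-assignment. Rules: - Axiom: infer $P,\neg P$ from no premises. - $(\&)$: from $\Gamma,A$ and $\Gamma,B$ infer $\Gamma,A\wedge B$. - $(\otimes)$: from $\Delta,A$ and $\Sigma,B$ infer $\Delta,\Sigma,A\wedge B$. - $(\wedge)$: from $\Gamma,\Delta,A$ and $\Gamma,\Sigma,B$ infer $\Gamma,\Delta,\Sigma,A\wedge B$. - $(\oplus_i)$ for $i=1,2$: from $\Gamma,A_i$ infer $\Gamma,A_1\vee A_2$. - $(\mathrm{par})$: from $\Gamma,A,B$ infer $\Gamma,A\vee B$. - $(\mathsf W)$: from $\Gamma$ infer $\Gamma,A$. - $(\mathsf C)$: from $\Gamma,A,A$ infer $\Gamma,A$. An extended system is the axiom together with any subset of $\{(\otimes),(\wedge),(\&),(\oplus),(\mathrm{par}),(\mathsf C),(\mathsf W)\}$, where $(\oplus)$ denotes the pair $(\oplus_1),(\oplus_2)$. $\mathbf{Mp}$ is the axiom together with $(\wedge),(\oplus),(\mathrm{par})$. A rule is derivable in $S$ if, for every instance of it, the conclusion is derivable in $S$ from its premises used as extra leaves. $S$ contains $T$ if every rule of $T$ is derivable in $S$. A system is complete if every valid formula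 is derivable in it. *)

theory Defs
  imports "HOL-Library.Multiset"
begin

datatype 'v form =
    Pos 'v
  | Neg 'v
  | And "'v form" "'v form"
  | Or "'v form" "'v form"

fun neg :: "'v form \<Rightarrow> 'v form" where
  "neg (Pos p) = Neg p"
| "neg (Neg p) = Pos p"
| "neg (And A B) = Or (neg A) (neg B)"
| "neg (Or A B) = And (neg A) (neg B)"

fun truth :: "('v \<Rightarrow> bool) \<Rightarrow> 'v form \<Rightarrow> bool" where
  "truth \<phi> (Pos p) \<longleftrightarrow> \<phi> p"
| "truth \<phi> (Neg p) \<longleftrightarrow> \<not> \<phi> p"
| "truth \<phi> (And A B) \<longleftrightarrow> truth \<phi> A \<and> truth \<phi> B"
| "truth \<phi> (Or A B) \<longleftrightarrow> truth \<phi> A \<or> truth \<phi> B"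

definition valid :: "'v form \<Rightarrow> bool" where
  "valid A \<longleftrightarrow> (\<forall>\<phi>. truth \<phi> A)"

text \<open>A sequent is a nonempty multiset. Nonemptiness is not part of the type; the rules below
  mention only nonempty sequents (see \<open>all_rules_nonempty\<close>).\<close>

type_synonym 'v sequent = "'v form multiset"

text \<open>A rule is the set of its instances, each a list of premises with a conclusion;
  a system is a set of rules.\<close>

type_synonym 'v inference_rule = "('v sequent list \<times> 'v sequent) set"
type_synonym 'v proof_system = "'v inference_rule set"

definition axiom_rule :: "'v inference_rule" where
  "axiom_rule = {([], {#Pos p, neg (Pos p)#}) | p. True}"

definition with_rule :: "'v inference_rule" where
  "with_rule = {([\<Gamma> + {#A#}, \<Gamma> + {#B#}], \<Gamma> + {#And A B#}) | \<Gamma> A B. True}"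

definition tensor_rule :: "'v inference_rule" where
  "tensor_rule = {([\<Delta> + {#A#}, \<Sigma> + {#B#}], \<Delta> + \<Sigma> + {#And A B#}) | \<Delta> \<Sigma> A B. True}"

definition wedge_rule :: "'v inference_rule" where
  "wedge_rule =
    {([\<Gamma> + \<Delta> + {#A#}, \<Gamma> + \<Sigma> + {#B#}], \<Gamma> + \<Delta> + \<Sigma> + {#And A B#}) | \<Gamma> \<Delta> \<Sigma> A B. True}"

definition plus1_rule :: "'v inference_rule" where
  "plus1_rule = {([\<Gamma> + {#A1#}], \<Gamma> + {#Or A1 A2#}) | \<Gamma> A1 A2. True}"

definition plus2_rule :: "'v inference_rule" where
  "plus2_rule = {([\<Gamma> + {#A2#}], \<Gamma> + {#Or A1 A2#}) | \<Gamma> A1 A2. True}"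

definition par_rule :: "'v inference_rule" where
  "par_rule = {([\<Gamma> + {#A, B#}], \<Gamma> + {#Or A B#}) | \<Gamma> A B. True}"

text \<open>The side condition in weakening says that the premise is a sequent.\<close>

definition weakening_rule :: "'v inference_rule" where
  "weakening_rule = {([\<Gamma>], \<Gamma> + {#A#}) | \<Gamma> A. \<Gamma> \<noteq> {#}}"

definition contraction_rule :: "'v inference_rule" where
  "contraction_rule = {([\<Gamma> + {#A, A#}], \<Gamma> + {#A#}) | \<Gamma> A. True}"

lemma all_rules_nonempty:
  assumes "r \<in> {axiom_rule, with_rule, tensor_rule, wedge_rule, plus1_rule, plus2_rule,
    par_rule, weakening_rule, contraction_rule}"
    and "(ps, c) \<in> r"
  shows "c \<noteq> {#} \<and> {#} \<notin> set ps"
  using assms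
  by (auto simp: axiom_rule_def with_rule_def tensor_rule_def wedge_rule_def plus1_rule_def
      plus2_rule_def par_rule_def weakening_rule_def contraction_rule_def)

text \<open>The plus rules are adopted or omitted as a pair, hence the grouping into sets.\<close>

definition extended_system :: "'v proof_system \<Rightarrow> bool" where
  "extended_system S \<longleftrightarrow>
    (\<exists>R \<subseteq> {{tensor_rule}, {wedge_rule}, {with_rule}, {plus1_rule, plus2_rule}, {par_rule},
            {contraction_rule}, {weakening_rule}}.
      S = {axiom_rule} \<union> \<Union>R)"

definition Mp :: "'v proof_system" where
  "Mp = {axiom_rule, wedge_rule, plus1_rule, plus2_rule, par_rule}"

text \<open>Derivability in \<open>S\<close> with the sequents in \<open>L\<close> available as extra leaves.\<close>

inductive derivable_from :: "'v proof_system \<Rightarrow> 'v sequent set \<Rightarrow> 'v sequent \<Rightarrow> bool"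
  for S :: "'v proof_system" and L :: "'v sequent set" where
  leaf: "\<Gamma> \<in> L \<Longrightarrow> derivable_from S L \<Gamma>"
| infer: "\<lbrakk>r \<in> S; (ps, \<Gamma>) \<in> r; \<forall>\<Delta> \<in> set ps. derivable_from S L \<Delta>\<rbrakk> \<Longrightarrow> derivable_from S L \<Gamma>"

definition derivable_rule :: "'v proof_system \<Rightarrow> 'v inference_rule \<Rightarrow> bool" where
  "derivable_rule S r \<longleftrightarrow> (\<forall>(ps, \<Gamma>) \<in> r. derivable_from S (set ps) \<Gamma>)"

definition contains_system :: "'v proof_system \<Rightarrow> 'v proof_system \<Rightarrow> bool" where
  "contains_system S T \<longleftrightarrow> (\<forall>r \<in> T. derivable_rule S r)"

definition complete_system :: "'v proof_system \<Rightarrow> bool" where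
  "complete_system S \<longleftrightarrow> (\<forall>A. valid A \<longrightarrow> derivable_from S {} {#A#})"

end

theory Submission
  imports Defs
begin

text \<open>
  \<open>Mp\<close> is complete because every minimal valid sequent (one with no valid proper sub-multiset) is
  derivable by induction on its size: a disjunction in it can be undone by one of the plus rules
  or by par with a minimal premise, and for a conjunction the two premises shrink to minimal
  sequents whose contexts have the original context as their union, which is exactly the
  shape of the wedge rule. A valid formula, as a singleton, is minimal.

  Conversely, a system in which the wedge, plus or par rule is not derivable lies inside one of seven
  maximal systems, each of which misses some valid formula:
  \<^item> without par and plus, or without par and contraction: \<open>P \<or> \<not>P\<close>;
  \<^item> without plus and weakening, every variable of a derivable sequent occurs with both signs,
    so \<open>(P \<or> \<not>P) \<or> Q\<close> is missed;
  \<^item> without wedge, tensor and with, every conjunction is missed;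
  \<^item> without wedge, with and contraction, a weight argument rules out \<open>P \<or> (\<not>P \<and> \<not>P)\<close>;
  \<^item> without wedge, tensor and weakening, derivable sequents have at most two members, which
    bounds the search for a proof of \<open>(P \<and> (Q \<or> \<not>Q)) \<or> \<not>P\<close>;
  \<^item> without wedge, contraction and weakening, \<open>(P \<or> (\<not>P \<and> (\<not>P \<and> \<not>Q))) \<or> Q\<close> is missed: its outer
    conjunction would have to share \<open>P\<close> but not \<open>Q\<close> between its premises.
\<close>

section \<open>Derivability and containment\<close>

text \<open>Simplification turns \<open>\<Gamma> + {#A#}\<close> into
  \<open>add_mset A \<Gamma>\<close>. With the instances in this normal form, inverting a rule comes
  down to equations between multisets.\<close>

lemma mem_rules:
  "(ps, \<Gamma>) \<in> axiom_rule \<longleftrightarrow> (\<exists>p. ps = [] \<and> \<Gamma> = {#Pos p, Neg p#})"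
  "(ps, \<Gamma>) \<in> with_rule \<longleftrightarrow>
    (\<exists>\<Theta> A B. ps = [add_mset A \<Theta>, add_mset B \<Theta>] \<and> \<Gamma> = add_mset (And A B) \<Theta>)"
  "(ps, \<Gamma>) \<in> tensor_rule \<longleftrightarrow>
    (\<exists>\<Delta> \<Sigma> A B. ps = [add_mset A \<Delta>, add_mset B \<Sigma>] \<and> \<Gamma> = add_mset (And A B) (\<Delta> + \<Sigma>))"
  "(ps, \<Gamma>) \<in> wedge_rule \<longleftrightarrow>
    (\<exists>\<Theta> \<Delta> \<Sigma> A B. ps = [add_mset A (\<Theta> + \<Delta>), add_mset B (\<Theta> + \<Sigma>)] \<and>
      \<Gamma> = add_mset (And A B) (\<Theta> + \<Delta> + \<Sigma>))"
  "(ps, \<Gamma>) \<in> plus1_rule \<longleftrightarrow> (\<exists>\<Theta> A B. ps = [add_mset A \<Theta>] \<and> \<Gamma> = add_mset (Or A B) \<Theta>)"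
  "(ps, \<Gamma>) \<in> plus2_rule \<longleftrightarrow> (\<exists>\<Theta> A B. ps = [add_mset B \<Theta>] \<and> \<Gamma> = add_mset (Or A B) \<Theta>)"
  "(ps, \<Gamma>) \<in> par_rule \<longleftrightarrow>
    (\<exists>\<Theta> A B. ps = [add_mset A (add_mset B \<Theta>)] \<and> \<Gamma> = add_mset (Or A B) \<Theta>)"
  "(ps, \<Gamma>) \<in> weakening_rule \<longleftrightarrow> (\<exists>\<Theta> A. \<Theta> \<noteq> {#} \<and> ps = [\<Theta>] \<and> \<Gamma> = add_mset A \<Theta>)"
  "(ps, \<Gamma>) \<in> contraction_rule \<longleftrightarrow>
    (\<exists>\<Theta> A. ps = [add_mset A (add_mset A \<Theta>)] \<and> \<Gamma> = add_mset A \<Theta>)"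
  by (auto simp: axiom_rule_def with_rule_def tensor_rule_def wedge_rule_def plus1_rule_def
      plus2_rule_def par_rule_def weakening_rule_def contraction_rule_def add_mset_commute; fail)+

lemma derivable_from_trans:
  assumes "derivable_from S L \<Gamma>" and "\<And>\<Delta>. \<Delta> \<in> L \<Longrightarrow> derivable_from S L' \<Delta>"
  shows "derivable_from S L' \<Gamma>"
  using assms by (induction rule: derivable_from.induct) (auto intro: derivable_from.infer)

text \<open>Each inference of \<open>T\<close> is replaced by its derivation in \<open>S\<close>,
  and the derivations already obtained for its premises are grafted onto the leaves.\<close>

lemma derivable_from_contains_system:
  assumes "derivable_from T L \<Gamma>" and "contains_system S T"
  shows "derivable_from S L \<Gamma>"
  using assms(1)
proof (induction rule: derivable_from.induct)
  case (leaf \<Gamma>)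
  then show ?case by (rule derivable_from.leaf)
next
  case (infer r ps \<Gamma>)
  then have "derivable_from S (set ps) \<Gamma>"
    using assms(2) by (auto simp: contains_system_def derivable_rule_def)
  then show ?case
    using infer by (auto intro: derivable_from_trans)
qed

lemma derivable_rule_mem:
  assumes "r \<in> S"
  shows "derivable_rule S r"
  using assms unfolding derivable_rule_def by (auto intro: derivable_from.intros)

section \<open>Single inferences inside derivations\<close>

lemma derivable_axiom:
  assumes "axiom_rule \<in> S"
  shows "derivable_from S L {#Pos p, Neg p#}"
  using assms by (rule derivable_from.infer[where ps = "[]"]) (auto simp: axiom_rule_def)

lemma derivable_with:
  assumes "with_rule \<in> S" "derivable_from S L (add_mset A \<Gamma>)" "derivable_from S L (add_mset B \<Gamma>)"
  shows "derivable_from S L (add_mset (And A B) \<Gamma>)"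
  using assms
  by (intro derivable_from.infer[where ps = "[\<Gamma> + {#A#}, \<Gamma> + {#B#}]"])
    (auto simp: with_rule_def)

lemma derivable_tensor:
  assumes "tensor_rule \<in> S" "derivable_from S L (add_mset A \<Delta>)" "derivable_from S L (add_mset B \<Sigma>)"
  shows "derivable_from S L (add_mset (And A B) (\<Delta> + \<Sigma>))"
  using assms
  by (intro derivable_from.infer[where ps = "[\<Delta> + {#A#}, \<Sigma> + {#B#}]"])
    (auto simp: tensor_rule_def)

lemma derivable_wedge:
  assumes "wedge_rule \<in> S" "derivable_from S L (add_mset A (\<Gamma> + \<Delta>))"
    "derivable_from S L (add_mset B (\<Gamma> + \<Sigma>))"
  shows "derivable_from S L (add_mset (And A B) (\<Gamma> + \<Delta> + \<Sigma>))"
  using assms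
  by (intro derivable_from.infer[where ps = "[\<Gamma> + \<Delta> + {#A#}, \<Gamma> + \<Sigma> + {#B#}]" and r = wedge_rule])
    (simp_all add: wedge_rule_def, blast)

lemma derivable_plus1:
  assumes "plus1_rule \<in> S" "derivable_from S L (add_mset A \<Gamma>)"
  shows "derivable_from S L (add_mset (Or A B) \<Gamma>)"
  using assms
  by (intro derivable_from.infer[where ps = "[\<Gamma> + {#A#}]"]) (auto simp: plus1_rule_def)

lemma derivable_plus2:
  assumes "plus2_rule \<in> S" "derivable_from S L (add_mset B \<Gamma>)"
  shows "derivable_from S L (add_mset (Or A B) \<Gamma>)"
  using assms
  by (intro derivable_from.infer[where ps = "[\<Gamma> + {#B#}]"]) (auto simp: plus2_rule_def)

lemma derivable_par:
  assumes "par_rule \<in> S" "derivable_from S L (add_mset A (add_mset B \<Gamma>))"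
  shows "derivable_from S L (add_mset (Or A B) \<Gamma>)"
  using assms
  by (intro derivable_from.infer[where ps = "[\<Gamma> + {#A, B#}]"]) (auto simp: par_rule_def)

lemma derivable_weakening:
  assumes "weakening_rule \<in> S" "derivable_from S L \<Gamma>" "\<Gamma> \<noteq> {#}"
  shows "derivable_from S L (\<Gamma> + \<Delta>)"
proof (induction \<Delta>)
  case (add A \<Delta>)
  then show ?case
    using assms by (intro derivable_from.infer[where ps = "[\<Gamma> + \<Delta>]" and r = weakening_rule])
      (auto simp: weakening_rule_def)
qed (use assms in simp)

lemma derivable_contraction:
  assumes "contraction_rule \<in> S" "derivable_from S L (\<Gamma> + \<Delta> + \<Delta>)"
  shows "derivable_from S L (\<Gamma> + \<Delta>)"
  using assms(2)
proof (induction \<Delta> arbitrary: \<Gamma>)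
  case (add A \<Delta>)
  have "derivable_from S L (\<Gamma> + \<Delta> + \<Delta> + {#A#})"
    using assms(1) add.prems
    by (intro derivable_from.infer[where ps = "[\<Gamma> + \<Delta> + \<Delta> + {#A, A#}]" and r = contraction_rule])
      (auto simp: contraction_rule_def)
  then show ?case
    using add.IH[of "add_mset A \<Gamma>"] by simp
qed simp

section \<open>Rule combinations that yield the rules of \<open>Mp\<close>\<close>

text \<open>With weakening, both premises are padded to the full context before the with rule
  applies. With contraction, the tensor rule duplicates the shared context \<open>\<Gamma>\<close>
  and the two copies are merged afterwards.\<close>

lemma derivable_rule_wedge:
  assumes "wedge_rule \<in> S \<or> with_rule \<in> S \<and> weakening_rule \<in> S
    \<or> tensor_rule \<in> S \<and> contraction_rule \<in> S"
  shows "derivable_rule S wedge_rule"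
proof -
  have "derivable_from S {add_mset A (\<Gamma> + \<Delta>), add_mset B (\<Gamma> + \<Sigma>)} (add_mset (And A B) (\<Gamma> + \<Delta> + \<Sigma>))"
    (is "derivable_from S ?L _") for \<Gamma> \<Delta> \<Sigma> A B
  proof -
    have prem: "derivable_from S ?L (add_mset A (\<Gamma> + \<Delta>))" "derivable_from S ?L (add_mset B (\<Gamma> + \<Sigma>))"
      by (auto intro: derivable_from.leaf)
    consider "wedge_rule \<in> S" | "with_rule \<in> S" "weakening_rule \<in> S"
      | "tensor_rule \<in> S" "contraction_rule \<in> S"
      using assms by blast
    then show ?thesis
    proof cases
      case 1
      then show ?thesis using derivable_wedge prem by blast
    next
      case 2
      have "derivable_from S ?L (add_mset A (\<Gamma> + \<Delta> + \<Sigma>))"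
        using derivable_weakening[OF 2(2) prem(1), of \<Sigma>] by simp
      moreover have "derivable_from S ?L (add_mset B (\<Gamma> + \<Delta> + \<Sigma>))"
        using derivable_weakening[OF 2(2) prem(2), of \<Delta>] by (simp add: ac_simps)
      ultimately show ?thesis
        by (rule derivable_with[OF 2(1)])
    next
      case 3
      show ?thesis
        using derivable_tensor[OF 3(1) prem]
          derivable_contraction[OF 3(2), of ?L "add_mset (And A B) (\<Delta> + \<Sigma>)" \<Gamma>]
        by (simp add: ac_simps)
    qed
  qed
  then show ?thesis
    by (auto simp: derivable_rule_def wedge_rule_def)
qed

text \<open>Weakening supplies the missing disjunct, after which par applies.\<close>

lemma derivable_rule_plus:
  assumes "plus1_rule \<in> S \<and> plus2_rule \<in> S \<or> par_rule \<in> S \<and> weakening_rule \<in> S"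
  shows "derivable_rule S plus1_rule" "derivable_rule S plus2_rule"
proof -
  consider "plus1_rule \<in> S" "plus2_rule \<in> S" | "par_rule \<in> S" "weakening_rule \<in> S"
    using assms by blast
  then have "derivable_rule S plus1_rule \<and> derivable_rule S plus2_rule"
  proof cases
    case 1
    then show ?thesis by (simp add: derivable_rule_mem)
  next
    case 2
    have *: "derivable_from S {add_mset A \<Gamma>} (add_mset B (add_mset A \<Gamma>))" for A B \<Gamma>
      using derivable_weakening[OF 2(2) derivable_from.leaf[of "add_mset A \<Gamma>" "{add_mset A \<Gamma>}" S], of "{#B#}"]
      by simp
    have "derivable_from S {add_mset A \<Gamma>} (add_mset (Or A B) \<Gamma>)" for A B \<Gamma>
      using derivable_par[OF 2(1)] *[of A \<Gamma> B] by (simp add: add_mset_commute)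
    moreover have "derivable_from S {add_mset A \<Gamma>} (add_mset (Or B A) \<Gamma>)" for A B \<Gamma>
      using derivable_par[OF 2(1)] * by blast
    ultimately show ?thesis
      by (auto simp: derivable_rule_def plus1_rule_def plus2_rule_def)
  qed
  then show "derivable_rule S plus1_rule" "derivable_rule S plus2_rule"
    by auto
qed

text \<open>One plus rule turns \<open>A\<close> into \<open>Or A B\<close>, the other turns
  \<open>B\<close> into a second copy of it, and contraction merges the copies.\<close>

lemma derivable_rule_par:
  assumes "par_rule \<in> S \<or> plus1_rule \<in> S \<and> plus2_rule \<in> S \<and> contraction_rule \<in> S"
  shows "derivable_rule S par_rule"
proof -
  consider "par_rule \<in> S" | "plus1_rule \<in> S" "plus2_rule \<in> S" "contraction_rule \<in> S"
    using assms by blast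
  then show ?thesis
  proof cases
    case 1
    then show ?thesis by (rule derivable_rule_mem)
  next
    case 2
    have "derivable_from S {add_mset A (add_mset B \<Gamma>)} (add_mset (Or A B) \<Gamma>)" for A B \<Gamma>
    proof -
      have "derivable_from S {add_mset A (add_mset B \<Gamma>)} (add_mset (Or A B) (add_mset B \<Gamma>))"
        by (intro derivable_plus1 2 derivable_from.leaf) simp
      then have "derivable_from S {add_mset A (add_mset B \<Gamma>)} (add_mset (Or A B) (add_mset (Or A B) \<Gamma>))"
        by (intro derivable_plus2 2) (simp add: add_mset_commute)
      then show ?thesis
        using derivable_contraction[OF 2(3), of _ \<Gamma> "{#Or A B#}"] by simp
    qed
    then show ?thesis
      by (auto simp: derivable_rule_def par_rule_def)
  qed
qed

section \<open>Minimal valid sequents\<close>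

text \<open>A sequent is read as the disjunction of its members. The empty one is never valid, which
  makes every valid singleton minimal.\<close>

definition valid_sequent :: "'v sequent \<Rightarrow> bool" where
  "valid_sequent \<Gamma> \<longleftrightarrow> (\<forall>\<phi>. \<exists>A \<in># \<Gamma>. truth \<phi> A)"

definition minimal_sequent :: "'v sequent \<Rightarrow> bool" where
  "minimal_sequent \<Gamma> \<longleftrightarrow> valid_sequent \<Gamma> \<and> (\<forall>\<Delta>. \<Delta> \<subset># \<Gamma> \<longrightarrow> \<not> valid_sequent \<Delta>)"

lemma valid_sequent_mono: "valid_sequent \<Delta> \<Longrightarrow> \<Delta> \<subseteq># \<Gamma> \<Longrightarrow> valid_sequent \<Gamma>"
  unfolding valid_sequent_def by (meson mset_subset_eqD)

lemma minimal_sequentD: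
  assumes "minimal_sequent \<Gamma>" "\<Delta> \<subseteq># \<Gamma>" "valid_sequent \<Delta>"
  shows "\<Delta> = \<Gamma>"
  using assms unfolding minimal_sequent_def subset_mset.less_le by blast

lemma ex_minimal_sequent:
  assumes "valid_sequent \<Gamma>"
  shows "\<exists>\<Delta>. \<Delta> \<subseteq># \<Gamma> \<and> minimal_sequent \<Delta>"
  using assms
proof (induction "size \<Gamma>" arbitrary: \<Gamma> rule: less_induct)
  case less
  show ?case
  proof (cases "minimal_sequent \<Gamma>")
    case False
    then obtain \<Delta> where "\<Delta> \<subset># \<Gamma>" "valid_sequent \<Delta>"
      using less.prems by (auto simp: minimal_sequent_def)
    with less.hyps[of \<Delta>] show ?thesis
      by (meson mset_subset_size subset_mset.less_imp_le subset_mset.order_trans)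
  qed auto
qed

lemma minimal_sequent_literals:
  assumes "minimal_sequent \<Gamma>" and lit: "\<And>A. A \<in># \<Gamma> \<Longrightarrow> \<exists>p. A = Pos p \<or> A = Neg p"
  obtains p where "\<Gamma> = {#Pos p, Neg p#}"
proof -
  \<comment> \<open>This assignment falsifies every negative literal of \<open>\<Gamma>\<close>. The
    true member is therefore some \<open>Pos p\<close>, and it is true only because
    \<open>Neg p\<close> occurs as well.\<close>
  have "\<exists>A \<in># \<Gamma>. truth (\<lambda>p. Neg p \<in># \<Gamma>) A"
    using assms(1) unfolding minimal_sequent_def valid_sequent_def by blast
  then obtain A where A: "A \<in># \<Gamma>" "truth (\<lambda>p. Neg p \<in># \<Gamma>) A"
    by blast
  then obtain p where p: "Pos p \<in># \<Gamma>" "Neg p \<in># \<Gamma>"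
    using lit[OF A(1)] by auto
  then have "{#Pos p, Neg p#} \<subseteq># \<Gamma>"
    by (auto simp: insert_subset_eq_iff in_diff_count)
  moreover have "valid_sequent {#Pos p, Neg p#}"
    by (auto simp: valid_sequent_def)
  ultimately show ?thesis
    using minimal_sequentD[OF assms(1)] that by metis
qed

text \<open>Replacing the disjunction by both disjuncts keeps validity. A minimal part of the result
  still contains all of \<open>\<Gamma>\<close>, and it contains a disjunct besides because
  \<open>\<Gamma>\<close> alone is not valid.\<close>

lemma minimal_sequent_Or:
  assumes min: "minimal_sequent (add_mset (Or A B) \<Gamma>)"
  shows "minimal_sequent (add_mset A \<Gamma>) \<or> minimal_sequent (add_mset B \<Gamma>)
    \<or> minimal_sequent (add_mset A (add_mset B \<Gamma>))"
proof -
  have "valid_sequent (add_mset A (add_mset B \<Gamma>))"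
    using min by (auto simp: minimal_sequent_def valid_sequent_def)
  then obtain \<Delta> where \<Delta>: "\<Delta> \<subseteq># add_mset A (add_mset B \<Gamma>)" "minimal_sequent \<Delta>"
    using ex_minimal_sequent by blast
  \<comment> \<open>Putting the disjunction back in place of \<open>A\<close> and \<open>B\<close>
    gives a valid part of the original sequent, so minimality excludes a proper
    \<open>\<Theta>\<close>.\<close>
  have collapse: "\<Theta> = \<Gamma>" if "\<Theta> \<subseteq># \<Gamma>" "valid_sequent (add_mset A (add_mset B \<Theta>))" for \<Theta>
    using minimal_sequentD[OF min, of "add_mset (Or A B) \<Theta>"] that
    by (auto simp: valid_sequent_def)
  have val: "valid_sequent \<Delta>"
    using \<Delta> by (simp add: minimal_sequent_def)
  \<comment> \<open>Members of \<open>\<Delta>\<close> are charged to \<open>\<Gamma>\<close> first,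
    with multiplicity. The excess then fits into \<open>{#A, B#}\<close> even if \<open>A\<close> or
    \<open>B\<close> also occurs in \<open>\<Gamma>\<close>.\<close>
  define \<Theta> where "\<Theta> = \<Delta> \<inter># \<Gamma>"
  obtain \<Lambda> where \<Lambda>: "\<Delta> = \<Lambda> + \<Theta>" "\<Lambda> \<subseteq># {#A, B#}"
  proof
    show "\<Delta> = (\<Delta> - \<Gamma>) + \<Theta>"
      unfolding \<Theta>_def by (auto simp: multiset_eq_iff min_def)
    show "\<Delta> - \<Gamma> \<subseteq># {#A, B#}"
      using \<Delta>(1) by (simp add: subset_eq_diff_conv)
  qed
  have "\<Theta> = \<Gamma>"
  proof (rule collapse)
    show "\<Theta> \<subseteq># \<Gamma>"
      by (simp add: \<Theta>_def)
    have "\<Delta> \<subseteq># add_mset A (add_mset B \<Theta>)"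
      using subset_mset.add_right_mono[OF \<Lambda>(2), of \<Theta>] unfolding \<Lambda>(1)[symmetric] by simp
    then show "valid_sequent (add_mset A (add_mset B \<Theta>))"
      by (rule valid_sequent_mono[OF val])
  qed
  moreover have "\<not> valid_sequent \<Gamma>"
    using minimal_sequentD[OF min, of \<Gamma>] by auto
  moreover have "\<Lambda> \<in> {{#}, {#A#}, {#B#}, {#A, B#}}"
  proof (cases \<Lambda>)
    case (add C \<Lambda>')
    have single: "M = {#} \<or> M = {#D#}" if "M \<subseteq># {#D#}" for M and D :: "'a form"
      using that by (metis mset_subset_eq_exists_conv union_is_single)
    have "C = A \<or> C = B"
      using \<Lambda>(2) add by (auto dest: mset_subset_eqD)
    then show ?thesis
      using \<Lambda>(2) add single[of \<Lambda>' A] single[of \<Lambda>' B] by (auto simp: add_mset_commute[of B A])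
  qed simp
  ultimately show ?thesis
    using \<Delta>(2) val \<Lambda>(1) by auto
qed

text \<open>Each premise shrinks to a minimal sequent, which keeps \<open>A\<close> or
  \<open>B\<close> respectively because \<open>\<Gamma>\<close> alone is not valid. The union takes
  maximal multiplicities and so stays inside \<open>\<Gamma>\<close>; minimality of the conclusion
  then forces equality.\<close>

lemma minimal_sequent_And:
  assumes min: "minimal_sequent (add_mset (And A B) \<Gamma>)"
  obtains \<Gamma>1 \<Gamma>2 where "minimal_sequent (add_mset A \<Gamma>1)" "minimal_sequent (add_mset B \<Gamma>2)"
    "\<Gamma>1 \<union># \<Gamma>2 = \<Gamma>"
proof -
  have nval: "\<not> valid_sequent \<Gamma>"
    using minimal_sequentD[OF min, of \<Gamma>] by auto
  have part: "\<exists>\<Gamma>'. \<Gamma>' \<subseteq># \<Gamma> \<and> minimal_sequent (add_mset C \<Gamma>')" if "C \<in> {A, B}" for C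
  proof -
    have "valid_sequent (add_mset C \<Gamma>)"
      using min that by (auto simp: minimal_sequent_def valid_sequent_def)
    then obtain \<Delta> where \<Delta>: "\<Delta> \<subseteq># add_mset C \<Gamma>" "minimal_sequent \<Delta>"
      using ex_minimal_sequent by blast
    have "\<not> \<Delta> \<subseteq># \<Gamma>"
      using nval valid_sequent_mono[of \<Delta> \<Gamma>] \<Delta>(2) by (auto simp: minimal_sequent_def)
    then have "C \<in># \<Delta>"
      using \<Delta>(1) by (metis add_mset_remove_trivial diff_single_trivial subset_eq_diff_conv union_mset_add_mset_right add.right_neutral)
    then obtain \<Gamma>' where "\<Delta> = add_mset C \<Gamma>'"
      by (metis insert_DiffM)
    then show ?thesis
      using \<Delta> by auto
  qed
  obtain \<Gamma>1 where \<Gamma>1: "\<Gamma>1 \<subseteq># \<Gamma>" "minimal_sequent (add_mset A \<Gamma>1)"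
    using part[of A] by auto
  obtain \<Gamma>2 where \<Gamma>2: "\<Gamma>2 \<subseteq># \<Gamma>" "minimal_sequent (add_mset B \<Gamma>2)"
    using part[of B] by auto
  have "valid_sequent (add_mset (And A B) (\<Gamma>1 \<union># \<Gamma>2))"
    using \<Gamma>1(2) \<Gamma>2(2) by (fastforce simp: minimal_sequent_def valid_sequent_def)
  then have "\<Gamma>1 \<union># \<Gamma>2 = \<Gamma>"
    using minimal_sequentD[OF min, of "add_mset (And A B) (\<Gamma>1 \<union># \<Gamma>2)"] \<Gamma>1(1) \<Gamma>2(1) by simp
  then show ?thesis
    using that \<Gamma>1(2) \<Gamma>2(2) by blast
qed

lemma minimal_sequent_derivable:
  assumes "minimal_sequent \<Gamma>"
  shows "derivable_from Mp L \<Gamma>"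
  using assms
\<comment> \<open>Undoing par lengthens the sequent, so the measure adds up formula sizes instead of
  counting members.\<close>
proof (induction "\<Sum>A\<in>#\<Gamma>. size A" arbitrary: \<Gamma> rule: less_induct)
  case less
  show ?case
  proof (cases "\<forall>A \<in># \<Gamma>. \<exists>p. A = Pos p \<or> A = Neg p")
    case True
    then obtain p where "\<Gamma> = {#Pos p, Neg p#}"
      using less.prems minimal_sequent_literals by metis
    then show ?thesis
      by (simp add: derivable_axiom Mp_def)
  next
    case False
    then obtain C where C: "C \<in># \<Gamma>" "\<nexists>p. C = Pos p \<or> C = Neg p"
      by blast
    then obtain \<Delta> where \<Gamma>: "\<Gamma> = add_mset C \<Delta>"
      by (metis insert_DiffM)
    show ?thesis
    proof (cases C)
      case (And A B)
      obtain \<Gamma>1 \<Gamma>2 where *: "minimal_sequent (add_mset A \<Gamma>1)" "minimal_sequent (add_mset B \<Gamma>2)"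
        "\<Gamma>1 \<union># \<Gamma>2 = \<Delta>"
        using minimal_sequent_And less.prems And \<Gamma> by metis
      have le: "(\<Sum>A\<in>#\<Gamma>'. size A) \<le> (\<Sum>A\<in>#\<Delta>. size A)" if "\<Gamma>' \<subseteq># \<Delta>" for \<Gamma>'
        using that by (auto simp: subset_mset.le_iff_add)
      have sub: "\<Gamma>1 \<subseteq># \<Delta>" "\<Gamma>2 \<subseteq># \<Delta>"
        using *(3) by auto
      have "derivable_from Mp L (add_mset A \<Gamma>1)" "derivable_from Mp L (add_mset B \<Gamma>2)"
        using less.hyps * le[OF sub(1)] le[OF sub(2)] And \<Gamma> by simp_all
      \<comment> \<open>The intersection serves as the shared context of the wedge rule and the two
        differences as the private ones.\<close>
      moreover have "\<Gamma>1 = \<Gamma>1 \<inter># \<Gamma>2 + (\<Gamma>1 - \<Gamma>2)" "\<Gamma>2 = \<Gamma>1 \<inter># \<Gamma>2 + (\<Gamma>2 - \<Gamma>1)"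
        "\<Delta> = \<Gamma>1 \<inter># \<Gamma>2 + (\<Gamma>1 - \<Gamma>2) + (\<Gamma>2 - \<Gamma>1)"
        unfolding *(3)[symmetric] by (auto simp: multiset_eq_iff min_def max_def)
      ultimately show ?thesis
        using derivable_wedge[of Mp L A "\<Gamma>1 \<inter># \<Gamma>2" "\<Gamma>1 - \<Gamma>2" B "\<Gamma>2 - \<Gamma>1"] And \<Gamma>
        by (simp add: Mp_def)
    next
      case (Or A B)
      then consider "minimal_sequent (add_mset A \<Delta>)" | "minimal_sequent (add_mset B \<Delta>)"
        | "minimal_sequent (add_mset A (add_mset B \<Delta>))"
        using minimal_sequent_Or less.prems \<Gamma> by metis
      then show ?thesis
      proof cases
        case 1
        then have "derivable_from Mp L (add_mset A \<Delta>)"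
          using less.hyps Or \<Gamma> by simp
        then show ?thesis
          using Or \<Gamma> by (simp add: derivable_plus1 Mp_def)
      next
        case 2
        then have "derivable_from Mp L (add_mset B \<Delta>)"
          using less.hyps Or \<Gamma> by simp
        then show ?thesis
          using Or \<Gamma> by (simp add: derivable_plus2 Mp_def)
      next
        case 3
        then have "derivable_from Mp L (add_mset A (add_mset B \<Delta>))"
          using less.hyps Or \<Gamma> by simp
        then show ?thesis
          using Or \<Gamma> by (simp add: derivable_par Mp_def)
      qed
    qed (use C in auto)
  qed
qed

lemma complete_Mp: "complete_system Mp"
  unfolding complete_system_def
proof (intro allI impI)
  fix A :: "'v form"
  assume "valid A"
  then have "minimal_sequent {#A#}"
    by (auto simp: minimal_sequent_def valid_sequent_def valid_def dest: mset_subset_size)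
  then show "derivable_from Mp {} {#A#}"
    by (rule minimal_sequent_derivable)
qed

section \<open>Incomplete systems\<close>

abbreviation all_rules :: "'v proof_system" where
  "all_rules \<equiv> {axiom_rule, with_rule, tensor_rule, wedge_rule, plus1_rule, plus2_rule,
    par_rule, weakening_rule, contraction_rule}"

section \<open>Soundness for evaluations\<close>

lemma derivable_invariant [consumes 1, case_names infer]:
  assumes "derivable_from S {} \<Gamma>"
    and "\<And>r ps \<Gamma>. r \<in> S \<Longrightarrow> (ps, \<Gamma>) \<in> r \<Longrightarrow> \<forall>\<Delta> \<in> set ps. P \<Delta> \<Longrightarrow> P \<Gamma>"
  shows "P \<Gamma>"
  using assms(1) by (induction rule: derivable_from.induct) (auto intro: assms(2))

text \<open>Stated for an arbitrary evaluation, so that a connective without introduction rules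
  may be interpreted as false.\<close>

lemma derivable_sound:
  assumes "derivable_from S {} \<Gamma>"
    and "S \<subseteq> {axiom_rule, weakening_rule, contraction_rule} \<union> R \<union> R'"
    and "R \<subseteq> {with_rule, tensor_rule, wedge_rule}" "R' \<subseteq> {plus1_rule, plus2_rule, par_rule}"
    and "\<And>p. v (Pos p) \<or> v (Neg p)"
    and "\<And>A B. R \<noteq> {} \<Longrightarrow> v A \<Longrightarrow> v B \<Longrightarrow> v (And A B)"
    and "\<And>A B. R' \<noteq> {} \<Longrightarrow> v A \<or> v B \<Longrightarrow> v (Or A B)"
  shows "\<exists>A \<in># \<Gamma>. v A"
  using assms(1)
proof (induction rule: derivable_invariant)
  case (infer r ps \<Gamma>)
  from infer(1) consider "r \<in> {axiom_rule, weakening_rule, contraction_rule}" | "r \<in> R" | "r \<in> R'"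
    using assms(2) by blast
  then show ?case
  proof cases
    case 1
    with infer assms(5) show ?thesis by (auto simp: mem_rules)
  next
    case 2
    then have "r \<in> {with_rule, tensor_rule, wedge_rule}" "\<And>A B. v A \<Longrightarrow> v B \<Longrightarrow> v (And A B)"
      using assms(3,6) by auto
    with infer show ?thesis by (auto simp: mem_rules)
  next
    case 3
    then have "r \<in> {plus1_rule, plus2_rule, par_rule}" "\<And>A B. v A \<or> v B \<Longrightarrow> v (Or A B)"
      using assms(4,7) by auto
    with infer show ?thesis by (auto simp: mem_rules)
  qed
qed

lemma derivable_valid:
  assumes "derivable_from S {} \<Gamma>" and "S \<subseteq> all_rules"
  shows "valid_sequent \<Gamma>"
  unfolding valid_sequent_def
proof
  fix \<phi>
  show "\<exists>A \<in># \<Gamma>. truth \<phi> A"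
    by (rule derivable_sound[where R = "{with_rule, tensor_rule, wedge_rule}"
          and R' = "{plus1_rule, plus2_rule, par_rule}"]) (use assms in auto)
qed

lemma incompleteI: "valid A \<Longrightarrow> \<not> derivable_from S {} {#A#} \<Longrightarrow> \<not> complete_system S"
  by (auto simp: complete_system_def)

section \<open>Refutations by evaluations, last rules and invariants\<close>

text \<open>When no rule introduces a disjunction, the evaluation that is false exactly on
  disjunctions is sound.\<close>

lemma incomplete_no_disjunction:
  fixes S :: "'v proof_system"
  assumes "S \<subseteq> {axiom_rule, with_rule, tensor_rule, wedge_rule, weakening_rule, contraction_rule}"
  shows "\<not> complete_system S"
proof (rule incompleteI)
  fix p :: 'v
  show "valid (Or (Pos p) (Neg p))"
    by (simp add: valid_def)
  show "\<not> derivable_from S {} {#Or (Pos p) (Neg p)#}"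
  proof
    assume "derivable_from S {} {#Or (Pos p) (Neg p)#}"
    then have "\<exists>A \<in># {#Or (Pos p) (Neg p)#}. \<forall>B C. A \<noteq> Or B C"
      by (rule derivable_sound[where R = "{with_rule, tensor_rule, wedge_rule}" and R' = "{}"])
        (use assms in auto)
    then show False
      by simp
  qed
qed

text \<open>Only a plus rule can conclude a lone disjunction, since weakening needs a nonempty
  premise. Its premise is then a lone literal, which is not valid.\<close>

lemma incomplete_no_par_contraction:
  fixes S :: "'v proof_system"
  assumes "S \<subseteq> {axiom_rule, with_rule, tensor_rule, wedge_rule, plus1_rule, plus2_rule, weakening_rule}"
  shows "\<not> complete_system S"
proof (rule incompleteI)
  fix p :: 'v
  show "valid (Or (Pos p) (Neg p))"
    by (simp add: valid_def)
  have sub: "S \<subseteq> all_rules"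
    using assms by blast
  show "\<not> derivable_from S {} {#Or (Pos p) (Neg p)#}"
  proof
    assume "derivable_from S {} {#Or (Pos p) (Neg p)#}"
    then have "derivable_from S {} {#Pos p#} \<or> derivable_from S {} {#Neg p#}"
      by (cases rule: derivable_from.cases) (use assms in \<open>auto simp: mem_rules\<close>)
    then show False
      using derivable_valid[OF _ sub] by (fastforce simp: valid_sequent_def)
  qed
qed

text \<open>Dually, the evaluation that is false exactly on conjunctions is sound here.\<close>

lemma incomplete_no_conjunction:
  fixes S :: "'v proof_system"
  assumes "S \<subseteq> {axiom_rule, plus1_rule, plus2_rule, par_rule, weakening_rule, contraction_rule}"
  shows "\<not> complete_system S"
proof (rule incompleteI)
  fix p :: 'v
  let ?T = "Or (Pos p) (Neg p)"
  show "valid (And ?T ?T)"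
    by (simp add: valid_def)
  show "\<not> derivable_from S {} {#And ?T ?T#}"
  proof
    assume "derivable_from S {} {#And ?T ?T#}"
    then have "\<exists>A \<in># {#And ?T ?T#}. \<forall>B C. A \<noteq> And B C"
      by (rule derivable_sound[where R = "{}" and R' = "{plus1_rule, plus2_rule, par_rule}"])
        (use assms in auto)
    then show False
      by simp
  qed
qed

primrec literals :: "'v form \<Rightarrow> 'v form set" where
  "literals (Pos p) = {Pos p}"
| "literals (Neg p) = {Neg p}"
| "literals (And A B) = literals A \<union> literals B"
| "literals (Or A B) = literals A \<union> literals B"

text \<open>Each remaining rule with premises gives its conclusion exactly the literals of those
  premises taken together, so the balance of signs in the axioms is inherited. In \<open>?A\<close>
  the variable \<open>q\<close> occurs only positively.\<close>

lemma incomplete_no_plus_weakening: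
  fixes S :: "'v proof_system"
  assumes "S \<subseteq> {axiom_rule, with_rule, tensor_rule, wedge_rule, par_rule, contraction_rule}"
    and "p \<noteq> (q :: 'v)"
  shows "\<not> complete_system S"
proof (rule incompleteI)
  let ?A = "Or (Or (Pos p) (Neg p)) (Pos q)"
  show "valid ?A"
    by (simp add: valid_def)
  have "(\<exists>A \<in># \<Gamma>. Pos x \<in> literals A) \<longleftrightarrow> (\<exists>A \<in># \<Gamma>. Neg x \<in> literals A)"
    if "derivable_from S {} \<Gamma>" for \<Gamma> x
    using that
  proof (induction rule: derivable_invariant)
    case (infer r ps \<Gamma>)
    from infer(1) have "r \<in> {axiom_rule, with_rule, tensor_rule, wedge_rule, par_rule, contraction_rule}"
      using assms(1) by blast
    with infer show ?case
      by (elim insertE; clarsimp simp: mem_rules bex_Un; argo)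
  qed
  from this[of "{#?A#}" q] show "\<not> derivable_from S {} {#?A#}"
    using assms(2) by auto
qed

text \<open>An axiom has weight 2, and every derivable sequent has weight at least 2 in the absence of
  wedge, with and contraction. Truncating the subtraction only increases the weight of a conjunction.\<close>

primrec weight :: "'v form \<Rightarrow> nat" where
  "weight (Pos p) = 1"
| "weight (Neg p) = 1"
| "weight (And A B) = weight A + weight B - 2"
| "weight (Or A B) = weight A + weight B"

text \<open>Tensor adds two weights of at least 2 and loses at most 2; the other rules with premises
  never lower the weight. The formula \<open>?A\<close> weighs 1 + (1 + 1 - 2) = 1.\<close>

lemma incomplete_no_wedge_with_contraction:
  fixes S :: "'v proof_system"
  assumes "S \<subseteq> {axiom_rule, tensor_rule, plus1_rule, plus2_rule, par_rule, weakening_rule}"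
  shows "\<not> complete_system S"
proof (rule incompleteI)
  fix p :: 'v
  let ?A = "Or (Pos p) (And (Neg p) (Neg p))"
  show "valid ?A"
    by (simp add: valid_def)
  have "2 \<le> (\<Sum>A\<in>#\<Gamma>. weight A)" if "derivable_from S {} \<Gamma>" for \<Gamma>
    using that
  proof (induction rule: derivable_invariant)
    case (infer r ps \<Gamma>)
    from infer(1) have "r \<in> {axiom_rule, tensor_rule, plus1_rule, plus2_rule, par_rule, weakening_rule}"
      using assms by blast
    with infer show ?case
      by (elim insertE; clarsimp simp: mem_rules; linarith)
  qed
  from this[of "{#?A#}"] show "\<not> derivable_from S {} {#?A#}"
    by auto
qed

section \<open>Refutations by backward proof search\<close>

text \<open>Axioms have two members, and no remaining rule has a conclusion longer than a
  premise.\<close>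

lemma derivable_size_le_2:
  assumes "derivable_from S {} \<Gamma>"
    and "S \<subseteq> {axiom_rule, with_rule, plus1_rule, plus2_rule, par_rule, contraction_rule}"
  shows "size \<Gamma> \<le> 2"
  using assms(1)
proof (induction rule: derivable_invariant)
  case (infer r ps \<Gamma>)
  from infer(1) have "r \<in> {axiom_rule, with_rule, plus1_rule, plus2_rule, par_rule, contraction_rule}"
    using assms(2) by blast
  with infer show ?case
    by (auto simp: mem_rules)
qed

text \<open>The size bound excludes par and contraction as last rules, since their premise would
  have three members. Either member of the pair may be principal, hence the doubled cases.\<close>

lemma derivable_pair_cases:
  assumes "derivable_from S {} {#X, Y#}"
    and sub: "S \<subseteq> {axiom_rule, with_rule, plus1_rule, plus2_rule, par_rule, contraction_rule}"
  obtains (ax) p where "{#X, Y#} = {#Pos p, Neg p#}"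
  | (And1) A B where "X = And A B" "derivable_from S {} {#A, Y#}" "derivable_from S {} {#B, Y#}"
  | (And2) A B where "Y = And A B" "derivable_from S {} {#X, A#}" "derivable_from S {} {#X, B#}"
  | (Or1) A B where "X = Or A B" "derivable_from S {} {#A, Y#} \<or> derivable_from S {} {#B, Y#}"
  | (Or2) A B where "Y = Or A B" "derivable_from S {} {#X, A#} \<or> derivable_from S {} {#X, B#}"
  using assms(1)
proof (cases rule: derivable_from.cases)
  case (infer r ps)
  have small: "size \<Delta> \<le> 2" if "\<Delta> \<in> set ps" for \<Delta>
    using derivable_size_le_2[OF _ sub] infer(3) that by blast
  from infer(1) sub
  have "r \<in> {axiom_rule, with_rule, plus1_rule, plus2_rule, par_rule, contraction_rule}"
    by blast
  then consider "r = axiom_rule" | "r = with_rule" | "r \<in> {plus1_rule, plus2_rule}"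
    | "r \<in> {par_rule, contraction_rule}"
    by blast
  then show ?thesis
  proof cases
    case 1
    then show ?thesis using infer ax by (auto simp: mem_rules)
  next
    case 2
    then obtain \<Theta> A B where *: "ps = [add_mset A \<Theta>, add_mset B \<Theta>]" "{#X, Y#} = add_mset (And A B) \<Theta>"
      using infer(2) by (auto simp: mem_rules)
    from *(2) consider "X = And A B" "\<Theta> = {#Y#}" | "Y = And A B" "\<Theta> = {#X#}"
      by (auto simp: add_eq_conv_ex)
    then show ?thesis
      using *(1) infer(3) And1 And2 by cases (auto simp: add_mset_commute)
  next
    case 3
    then have "\<exists>\<Theta> A B. (ps = [add_mset A \<Theta>] \<or> ps = [add_mset B \<Theta>]) \<and> {#X, Y#} = add_mset (Or A B) \<Theta>"
      using infer(2) by (elim insertE emptyE; hypsubst; unfold mem_rules; blast)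
    then obtain \<Theta> A B where *: "ps = [add_mset A \<Theta>] \<or> ps = [add_mset B \<Theta>]"
      "{#X, Y#} = add_mset (Or A B) \<Theta>"
      by blast
    from *(2) consider "X = Or A B" "\<Theta> = {#Y#}" | "Y = Or A B" "\<Theta> = {#X#}"
      by (auto simp: add_eq_conv_ex)
    then show ?thesis
      using *(1) infer(3) Or1[of A B] Or2[of A B] by cases (auto simp: add_mset_commute)
  next
    case 4
    then have False using infer small
      by (auto simp: mem_rules add_eq_conv_ex)
    then show ?thesis ..
  qed
qed simp

text \<open>Pairs are refuted from the top of the backward search down to \<open>F\<close>: each one
  is falsified by an assignment or can only be concluded with the help of a pair refuted
  before.\<close>

lemma incomplete_no_wedge_tensor_weakening:
  fixes S :: "'v proof_system"
  assumes sub: "S \<subseteq> {axiom_rule, with_rule, plus1_rule, plus2_rule, par_rule, contraction_rule}"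
    and "p \<noteq> (q :: 'v)"
  shows "\<not> complete_system S"
proof (rule incompleteI)
  let ?D = "derivable_from S {}"
  define T where "T = Or (Pos q) (Neg q)"
  define K where "K = And (Pos p) T"
  define F where "F = Or K (Neg p)"
  note defs = F_def K_def T_def
  show "valid F"
    by (simp add: defs valid_def)
  have valid: "\<exists>A \<in># \<Gamma>. truth \<phi> A" if "?D \<Gamma>" for \<Gamma> \<phi>
    using derivable_valid[OF that] sub unfolding valid_sequent_def by blast
  \<comment> \<open>Here \<open>a\<close> is the value of \<open>p\<close>, and \<open>b\<close>
    that of every other variable, in particular of \<open>q\<close>.\<close>
  have falsified: "\<not> ?D \<Gamma>" if "\<forall>A \<in># \<Gamma>. \<not> truth (\<lambda>x. if x = p then a else b) A" for \<Gamma> a b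
    using valid that by blast
  have invalid:
    "\<not> ?D {#Pos q, Neg p#}"
    "\<not> ?D {#Neg q, Neg p#}"
    "\<not> ?D {#Pos q, Pos p#}"
    "\<not> ?D {#Neg q, Pos p#}"
    "\<not> ?D {#Pos q, K#}"
    "\<not> ?D {#Neg q, K#}"
    "\<not> ?D {#K, K#}"
    "\<not> ?D {#Neg p, Neg p#}"
  proof -
    show "\<not> ?D {#Pos q, Neg p#}"
      using assms(2) by (intro falsified[of _ True False]) (simp add: defs)
    show "\<not> ?D {#Neg q, Neg p#}"
      using assms(2) by (intro falsified[of _ True True]) (simp add: defs)
    show "\<not> ?D {#Pos q, Pos p#}"
      using assms(2) by (intro falsified[of _ False False]) (simp add: defs)
    show "\<not> ?D {#Neg q, Pos p#}"
      using assms(2) by (intro falsified[of _ False True]) (simp add: defs)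
    show "\<not> ?D {#Pos q, K#}"
      using assms(2) by (intro falsified[of _ False False]) (simp add: defs)
    show "\<not> ?D {#Neg q, K#}"
      using assms(2) by (intro falsified[of _ False True]) (simp add: defs)
    show "\<not> ?D {#K, K#}"
      using assms(2) by (intro falsified[of _ False False]) (simp add: defs)
    show "\<not> ?D {#Neg p, Neg p#}"
      using assms(2) by (intro falsified[of _ True True]) (simp add: defs)
  qed
  have T_Np: "\<not> ?D {#T, Neg p#}"
  proof
    assume "?D {#T, Neg p#}"
    then show False
      by (cases rule: derivable_pair_cases[OF _ sub])
        (use invalid in \<open>auto simp: T_def add_eq_conv_ex\<close>)
  qed
  have T_Pp: "\<not> ?D {#T, Pos p#}"
  proof
    assume "?D {#T, Pos p#}"
    then show False
      by (cases rule: derivable_pair_cases[OF _ sub])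
        (use invalid in \<open>auto simp: T_def add_eq_conv_ex\<close>)
  qed
  have K_Np: "\<not> ?D {#K, Neg p#}"
  proof
    assume "?D {#K, Neg p#}"
    then show False
      by (cases rule: derivable_pair_cases[OF _ sub])
        (use T_Np in \<open>auto simp: K_def add_eq_conv_ex\<close>)
  qed
  have T_K: "\<not> ?D {#T, K#}"
  proof
    assume "?D {#T, K#}"
    then show False
      by (cases rule: derivable_pair_cases[OF _ sub])
        (use T_Pp invalid[unfolded K_def] in \<open>auto simp: T_def K_def add_eq_conv_ex\<close>)
  qed
  have Q_F: "\<not> ?D {#L, F#}" if "L = Pos q \<or> L = Neg q" for L
  proof
    assume "?D {#L, F#}"
    then show False
      by (cases rule: derivable_pair_cases[OF _ sub])
        (use that invalid assms(2) in \<open>auto simp: F_def add_eq_conv_ex\<close>)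
  qed
  have T_F: "\<not> ?D {#T, F#}"
  proof
    assume "?D {#T, F#}"
    then show False
      by (cases rule: derivable_pair_cases[OF _ sub])
        (use T_K T_Np Q_F in \<open>auto simp: T_def F_def add_eq_conv_ex\<close>)
  qed
  have K_F: "\<not> ?D {#K, F#}"
  proof
    assume "?D {#K, F#}"
    then show False
      by (cases rule: derivable_pair_cases[OF _ sub])
        (use T_F K_Np invalid in \<open>auto simp: K_def F_def add_eq_conv_ex\<close>)
  qed
  have Np_K: "\<not> ?D {#Neg p, K#}"
    using K_Np by (simp add: add_mset_commute)
  have Np_F: "\<not> ?D {#Neg p, F#}"
  proof
    assume "?D {#Neg p, F#}"
    then show False
      by (cases rule: derivable_pair_cases[OF _ sub])
        (use Np_K invalid in \<open>auto simp: F_def add_eq_conv_ex\<close>)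
  qed
  have F_K: "\<not> ?D {#F, K#}" and F_Np: "\<not> ?D {#F, Neg p#}"
    using K_F Np_F by (simp_all add: add_mset_commute)
  have F_F: "\<not> ?D {#F, F#}"
  proof
    assume "?D {#F, F#}"
    then show False
      by (cases rule: derivable_pair_cases[OF _ sub])
        (use K_F Np_F F_K F_Np in \<open>auto simp: F_def add_eq_conv_ex\<close>)
  qed
  show "\<not> ?D {#F#}"
  proof
    assume "?D {#F#}"
    \<comment> \<open>A lone \<open>F\<close> may come from plus, par or contraction; the last
      possibility is why \<open>F, F\<close> had to be refuted.\<close>
    then have "?D {#K#} \<or> ?D {#Neg p#} \<or> ?D {#K, Neg p#} \<or> ?D {#F, F#}"
      by (cases rule: derivable_from.cases) (use sub in \<open>auto simp: mem_rules F_def\<close>)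
    then show False
      using K_Np F_F falsified[of "{#K#}" False False] falsified[of "{#Neg p#}" True True]
      by (simp add: K_def)
  qed
qed

text \<open>The search arrives at \<open>K, P, Q\<close>. There the with rule asks for
  \<open>\<not>P, P, Q\<close>, and the tensor rule cannot give \<open>P\<close> to both conjuncts
  of \<open>K\<close>.\<close>

lemma incomplete_no_wedge_contraction_weakening:
  fixes S :: "'v proof_system"
  assumes sub: "S \<subseteq> {axiom_rule, with_rule, tensor_rule, plus1_rule, plus2_rule, par_rule}"
    and "p \<noteq> (q :: 'v)"
  shows "\<not> complete_system S"
proof (rule incompleteI)
  let ?D = "derivable_from S {}"
  define M where "M = And (Neg p) (Neg q)"
  define K where "K = And (Neg p) M"
  define F where "F = Or (Or (Pos p) K) (Pos q)"
  note defs = F_def K_def M_def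
  show "valid F"
    by (auto simp: defs valid_def)
  have valid: "\<exists>A \<in># \<Gamma>. truth \<phi> A" if "?D \<Gamma>" for \<Gamma> \<phi>
    using derivable_valid[OF that] sub unfolding valid_sequent_def by blast
  have falsified: "\<not> ?D \<Gamma>" if "\<forall>A \<in># \<Gamma>. \<not> truth (\<lambda>x. if x = p then a else b) A" for \<Gamma> a b
    using valid that by blast
  note invalid = falsified[of _ True True] falsified[of _ True False] falsified[of _ False True]
    falsified[of _ False False]
  \<comment> \<open>Only an axiom could conclude a sequent of literals, and an axiom has just two
    members.\<close>
  have literals: "\<not> ?D {#Neg p, Pos p, Pos q#}"
  proof
    assume "?D {#Neg p, Pos p, Pos q#}"
    then show False
      by (cases rule: derivable_from.cases)
        (use sub in \<open>auto simp: mem_rules add_eq_conv_ex\<close>)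
  qed
  \<comment> \<open>Validity of \<open>M, \<Sigma>\<close> requires both \<open>Pos p\<close> and
    \<open>Pos q\<close> in \<open>\<Sigma>\<close>, which leaves \<open>Neg p\<close> alone in the
    other premise.\<close>
  have split: "\<not> (?D (add_mset (Neg p) \<Delta>) \<and> ?D (add_mset M \<Sigma>))"
    if "\<Delta> + \<Sigma> = {#Pos p, Pos q#}" for \<Delta> \<Sigma>
  proof (cases "Pos p \<in># \<Sigma> \<and> Pos q \<in># \<Sigma>")
    case True
    then have "{#Pos p, Pos q#} \<subseteq># \<Sigma>"
      using assms(2) by (auto simp: insert_subset_eq_iff in_diff_count)
    then have "\<Delta> = {#}"
      using that by (metis add_cancel_left_left mset_subset_eq_add_right subset_mset.antisym)
    then show ?thesis
      using invalid[of "{#Neg p#}"] by auto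
  next
    case False
    have elem: "A = Pos p \<or> A = Pos q" if "A \<in># \<Sigma>" for A
      using that \<open>\<Delta> + \<Sigma> = {#Pos p, Pos q#}\<close>
      by (metis add_mset_add_single empty_iff insert_iff set_mset_add_mset_insert set_mset_empty union_iff)
    from False consider "\<forall>A \<in># \<Sigma>. A = Pos p" | "\<forall>A \<in># \<Sigma>. A = Pos q"
      using elem by blast
    then have "\<not> ?D (add_mset M \<Sigma>)"
    proof cases
      case 1
      then show ?thesis
        using assms(2) by (intro falsified[of _ False True]) (auto simp: M_def)
    next
      case 2
      then show ?thesis
        using assms(2) by (intro falsified[of _ True False]) (auto simp: M_def)
    qed
    then show ?thesis
      by blast
  qed
  have three: "\<not> ?D {#K, Pos p, Pos q#}"
  proof
    assume "?D {#K, Pos p, Pos q#}"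
    then show False
    proof (cases rule: derivable_from.cases)
      case (infer r ps)
      from infer(1) sub have "r = with_rule \<or> r = tensor_rule \<or>
        r \<in> {axiom_rule, plus1_rule, plus2_rule, par_rule}"
        by blast
      then show False
      proof (elim disjE)
        assume "r = with_rule"
        then show False
          using infer literals by (auto simp: mem_rules K_def add_eq_conv_ex)
      next
        assume "r = tensor_rule"
        then obtain \<Delta> \<Sigma> A B where "ps = [\<Delta> + {#A#}, \<Sigma> + {#B#}]"
          and eq: "{#K, Pos p, Pos q#} = \<Delta> + \<Sigma> + {#And A B#}"
          using infer(2) by (auto simp: tensor_rule_def)
        moreover have "And A B = K" "\<Delta> + \<Sigma> = {#Pos p, Pos q#}"
          using eq by (auto simp: K_def add_eq_conv_ex)
        ultimately show False
          using infer(3) split by (auto simp: K_def)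
      next
        assume "r \<in> {axiom_rule, plus1_rule, plus2_rule, par_rule}"
        then show False
          using infer by (auto simp: mem_rules K_def add_eq_conv_ex)
      qed
    qed simp
  qed
  have two: "\<not> ?D {#Or (Pos p) K, Pos q#}"
  proof
    assume "?D {#Or (Pos p) K, Pos q#}"
    then have "?D {#Pos p, Pos q#} \<or> ?D {#K, Pos q#} \<or> ?D {#K, Pos p, Pos q#}"
      by (cases rule: derivable_from.cases)
        (use sub in \<open>auto simp: mem_rules add_eq_conv_ex add_mset_commute\<close>)
    then show False
      using three invalid assms(2) by (auto simp: defs)
  qed
  show "\<not> ?D {#F#}"
  proof
    assume "?D {#F#}"
    then have "?D {#Or (Pos p) K#} \<or> ?D {#Pos q#} \<or> ?D {#Or (Pos p) K, Pos q#}"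
      by (cases rule: derivable_from.cases) (use sub in \<open>auto simp: mem_rules F_def\<close>)
    then show False
      using two invalid assms(2) by (auto simp: defs)
  qed
qed

section \<open>Combining the seven obstructions\<close>

theorem theorem20:
  fixes S :: "'v proof_system"
  assumes "infinite (UNIV :: 'v set)"
    and "extended_system S"
  shows "complete_system S \<longleftrightarrow> contains_system S Mp"
proof
  assume "contains_system S Mp"
  then show "complete_system S"
    using complete_Mp derivable_from_contains_system unfolding complete_system_def by blast
next
  assume complete: "complete_system S"
  \<comment> \<open>Three of the missed formulas use two distinct variables.\<close>
  obtain p q :: 'v where pq: "p \<noteq> q"
    using assms(1) ex_new_if_finite[of "{undefined :: 'v}"] by auto
  obtain R where R: "R \<subseteq> {{tensor_rule}, {wedge_rule}, {with_rule}, {plus1_rule, plus2_rule}, {par_rule},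
      {contraction_rule}, {weakening_rule}}" and S: "S = {axiom_rule} \<union> \<Union>R"
    using assms(2) unfolding extended_system_def by blast
  let ?plus = "{plus1_rule, plus2_rule}"
  \<comment> \<open>Each rule of \<open>S\<close> is traced back to its group in \<open>R\<close>.
    The remaining case analysis is then propositional in the groups chosen.\<close>
  have SR: "r = axiom_rule \<or> r = tensor_rule \<and> {tensor_rule} \<in> R \<or> r = wedge_rule \<and> {wedge_rule} \<in> R \<or>
    r = with_rule \<and> {with_rule} \<in> R \<or> (r = plus1_rule \<or> r = plus2_rule) \<and> ?plus \<in> R \<or>
    r = par_rule \<and> {par_rule} \<in> R \<or> r = contraction_rule \<and> {contraction_rule} \<in> R \<or>
    r = weakening_rule \<and> {weakening_rule} \<in> R" if r: "r \<in> S" for r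
  proof (cases "r = axiom_rule")
    case False
    then obtain X where X: "X \<in> R" "r \<in> X"
      using r S by blast
    from subsetD[OF R X(1)] X show ?thesis
      by (elim insertE emptyE; simp)
  qed simp
  have single: "{r} \<in> R \<longrightarrow> r \<in> S" for r
    using S by blast
  note mem = single[of tensor_rule] single[of wedge_rule] single[of with_rule] single[of par_rule]
    single[of contraction_rule] single[of weakening_rule]
  have plus: "?plus \<in> R \<longrightarrow> plus1_rule \<in> S" "?plus \<in> R \<longrightarrow> plus2_rule \<in> S"
    using S by blast+
  have "?plus \<in> R \<or> {par_rule} \<in> R"
    by (rule ccontr, rule incomplete_no_disjunction[THEN notE, OF _ complete])
      (intro subsetI, drule SR, simp, argo)
  moreover have "{par_rule} \<in> R \<or> {contraction_rule} \<in> R"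
    by (rule ccontr, rule incomplete_no_par_contraction[THEN notE, OF _ complete])
      (intro subsetI, drule SR, simp, argo)
  moreover have "?plus \<in> R \<or> {weakening_rule} \<in> R"
    by (rule ccontr, rule incomplete_no_plus_weakening[THEN notE, OF _ pq complete])
      (intro subsetI, drule SR, simp, argo)
  moreover have "{wedge_rule} \<in> R \<or> {with_rule} \<in> R \<or> {tensor_rule} \<in> R"
    by (rule ccontr, rule incomplete_no_conjunction[THEN notE, OF _ complete])
      (intro subsetI, drule SR, simp, argo)
  moreover have "{wedge_rule} \<in> R \<or> {with_rule} \<in> R \<or> {contraction_rule} \<in> R"
    by (rule ccontr, rule incomplete_no_wedge_with_contraction[THEN notE, OF _ complete])
      (intro subsetI, drule SR, simp, argo)
  moreover have "{wedge_rule} \<in> R \<or> {tensor_rule} \<in> R \<or> {weakening_rule} \<in> R"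
    by (rule ccontr, rule incomplete_no_wedge_tensor_weakening[THEN notE, OF _ pq complete])
      (intro subsetI, drule SR, simp, argo)
  moreover have "{wedge_rule} \<in> R \<or> {contraction_rule} \<in> R \<or> {weakening_rule} \<in> R"
    by (rule ccontr, rule incomplete_no_wedge_contraction_weakening[THEN notE, OF _ pq complete])
      (intro subsetI, drule SR, simp, argo)
  \<comment> \<open>The seven disjunctions are conjunctive normal forms of the hypotheses needed.
    The four mentioning wedge amount to wedge, or with and weakening, or tensor and contraction. The
    others give plus, or par and weakening; and par, or plus and contraction.\<close>
  ultimately have "derivable_rule S wedge_rule" "derivable_rule S plus1_rule"
    "derivable_rule S plus2_rule" "derivable_rule S par_rule"
    by (intro derivable_rule_wedge derivable_rule_plus derivable_rule_par; use mem plus in argo)+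
  moreover have "derivable_rule S axiom_rule"
    by (rule derivable_rule_mem) (simp add: S)
  ultimately show "contains_system S Mp"
    by (simp add: contains_system_def Mp_def)
qed

end
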